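(* Let $m$ be a nonnegative integer, $t$ a positive integer, and let $n_1,\ldots,n_t,k_1,\ldots,k_m$ be nonnegative integers such that $k_1+\cdots+k_m = n_1+\cdots+n_t$. Then $$\binom{n_1+\cdots+n_t}{k_1,\ldots,k_m}_q = \sum q^{\sum_{u=1}^t\sum_{v=2}^m f(r_{u,v})} \binom{n_1}{r_{1,1},\ldots,r_{1,m}}_q\cdots\binom{n_t}{r_{t,1},\ldots,r_{t,m}}_q,$$ where the outer sum is over all families of nonnegative integers $(r_{u,v})_{(u,v)\in[t]\times[m]}$ such that $r_{u,1}+\cdots+r_{u,m}=n_u$ for every $u\in[t]$ and $r_{1,v}+\cdots+r_{t,v}=k_v$ for every $v\in[m]$, and where $$f(r_{u,v}) = r_{u,v}\sum_{i=u+1}^t\sum_{j=1}^{v-1} r_{i,j}\qquad\text{for every }(u,v)\in[t]\times[m].$$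
   Context: $[n]=\{1,\ldots,n\}$ and $q$ is an indeterminate. Empty sums are $0$. $q$-binomial coefficients: for nonnegative integers $n\ge k$, $\binom{n}{k}_q := \sum_{E\subseteq [n],\,|E|=k} q^{\sum_{i=1}^k ((n-e_i)-(k-i))}$, where $E=\{e_1<\cdots<e_k\}$. $q$-multinomial coefficients: for nonnegative integers with $k_1+\cdots+k_m=n$, $\binom{n}{k_1,\ldots,k_m}_q := \binom{n}{k_m}_q\binom{n-k_m}{k_{m-1}}_q\cdots\binom{n-k_m-\cdots-k_2}{k_1}_q$. *)

theory Defs
  imports "HOL-Computational_Algebra.Polynomial" "HOL-Library.FuncSet"
begin

text \<open>
  The indeterminate \<open>q\<close> is that of \<open>int poly\<close>, so \<open>q\<close> to the power \<open>e\<close> is \<open>monom 1 e\<close>.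
  Sequences and families are functions on \<open>nat\<close>, of which only the values at the
  indices from \<open>1\<close> on are used.
\<close>

text \<open>
  Writing \<open>E = {e\<^sub>1 < \<dots> < e\<^sub>k}\<close>, the element \<open>e\<^sub>i\<close> is \<open>sorted_list_of_set E ! (i - 1)\<close>.
  No subtraction on \<open>nat\<close> is truncated: \<open>e\<^sub>i \<le> n\<close>, and the \<open>k - i\<close> elements of \<open>E\<close> that
  exceed \<open>e\<^sub>i\<close> lie in \<open>{e\<^sub>i + 1..n}\<close>, so that \<open>k - i \<le> n - e\<^sub>i\<close>.
\<close>
definition q_binomial :: "nat \<Rightarrow> nat \<Rightarrow> int poly" where
  "q_binomial n k =
    (\<Sum>E | E \<subseteq> {1..n} \<and> card E = k.
       monom 1 (\<Sum>i=1..k. (n - sorted_list_of_set E ! (i - 1)) - (k - i)))"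

text \<open>
  \<open>q_multinomial n m k\<close> has the upper entry \<open>n\<close> and the lower entries \<open>k 1, \<dots>, k m\<close>; it is
  meaningful when these sum to \<open>n\<close>. For \<open>m = 0\<close> (hence \<open>n = 0\<close>) it is the empty product \<open>1\<close>.
\<close>
definition q_multinomial :: "nat \<Rightarrow> nat \<Rightarrow> (nat \<Rightarrow> nat) \<Rightarrow> int poly" where
  "q_multinomial n m k = (\<Prod>j=1..m. q_binomial (n - (\<Sum>i=j+1..m. k i)) (k j))"

text \<open>
  Families indexed by \<open>{1..t} \<times> {1..m}\<close>, in curried form; extensionality makes each family
  be counted once. The row sums bound the entries, so the set is finite.
\<close>
definition contingency_arrays ::
    "nat \<Rightarrow> nat \<Rightarrow> (nat \<Rightarrow> nat) \<Rightarrow> (nat \<Rightarrow> nat) \<Rightarrow> (nat \<Rightarrow> nat \<Rightarrow> nat) set" where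
  "contingency_arrays t m n k =
    {r \<in> {1..t} \<rightarrow>\<^sub>E ({1..m} \<rightarrow>\<^sub>E UNIV).
       (\<forall>u\<in>{1..t}. (\<Sum>v=1..m. r u v) = n u) \<and>
       (\<forall>v\<in>{1..m}. (\<Sum>u=1..t. r u v) = k v)}"

lemma finite_contingency_arrays: "finite (contingency_arrays t m n k)"
proof (rule finite_subset)
  show "contingency_arrays t m n k \<subseteq> (\<Pi>\<^sub>E u\<in>{1..t}. {1..m} \<rightarrow>\<^sub>E {..n u})"
  proof
    fix r assume r: "r \<in> contingency_arrays t m n k"
    then have ext: "r \<in> {1..t} \<rightarrow>\<^sub>E ({1..m} \<rightarrow>\<^sub>E UNIV)"
      and row: "\<And>u. u \<in> {1..t} \<Longrightarrow> (\<Sum>v=1..m. r u v) = n u"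
      unfolding contingency_arrays_def by blast+
    have "r u v \<le> n u" if "u \<in> {1..t}" "v \<in> {1..m}" for u v
      using member_le_sum[of v "{1..m}" "r u"] that row[of u] by simp
    then show "r \<in> (\<Pi>\<^sub>E u\<in>{1..t}. {1..m} \<rightarrow>\<^sub>E {..n u})"
      using ext unfolding PiE_iff by blast
  qed
  show "finite (\<Pi>\<^sub>E u\<in>{1..t}. {1..m} \<rightarrow>\<^sub>E {..n u})"
    by (intro finite_PiE finite_atLeastAtMost finite_atMost)
qed

definition cross_weight :: "nat \<Rightarrow> (nat \<Rightarrow> nat \<Rightarrow> nat) \<Rightarrow> nat \<Rightarrow> nat \<Rightarrow> nat" where
  "cross_weight t r u v = r u v * (\<Sum>i=u+1..t. \<Sum>j=1..v-1. r i j)"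

end

theory Submission
  imports Defs
begin

text \<open>
  The \<open>q\<close>-multinomial coefficient is a product of \<open>q\<close>-binomial coefficients, one for each lower
  entry, and peeling off the last factor (lemma \<open>q_multinomial_Suc\<close>) chooses the positions of the
  largest letter in a word. Accordingly the identity is proved by peeling off the last column of the
  array \<open>r\<close>, by induction on \<open>m\<close>.

  A single column is governed by the \<open>q\<close>-Vandermonde identity for \<open>t\<close> blocks (lemma
  \<open>q_vandermonde_blocks\<close>): when \<open>{1..n\<^sub>1 + \<dots> + n\<^sub>t}\<close> is cut into consecutive blocks of sizes
  \<open>n\<^sub>1, \<dots>, n\<^sub>t\<close>, a subset \<open>E\<close> with \<open>s\<^sub>u\<close> elements in block \<open>u\<close> has as its exponent the number of
  pairs formed by an element of \<open>E\<close> and a later element outside \<open>E\<close>. The pairs inside one block give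
  the \<open>q\<close>-binomial coefficients of the blocks, and those across blocks give the power
  \<open>\<Sum>\<^sub>u s\<^sub>u \<Sum>\<^sub>i\<^sub>>\<^sub>u (n\<^sub>i - s\<^sub>i)\<close>. The identity for two blocks follows from the \<open>q\<close>-Pascal
  recurrence, and the one for \<open>t\<close> blocks by splitting off the last block repeatedly.

  If \<open>s\<close> is the last column of \<open>r\<close>, then \<open>n\<^sub>i - s\<^sub>i\<close> is the sum of the other entries of row \<open>i\<close>, so
  the power of \<open>q\<close> in the Vandermonde identity is exactly the cross weight of the last column. The
  remaining columns form an array with row sums \<open>n\<^sub>i - s\<^sub>i\<close>, to which the induction hypothesis
  applies.
\<close>

section \<open>The \<open>q\<close>-Pascal recurrence\<close>

lemma monom_1_add: "monom 1 (a + b) = monom (1 :: 'a :: comm_semiring_1) a * monom 1 b"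
  by (simp add: mult_monom)

lemma q_binomial_0_right: "q_binomial n 0 = 1"
proof -
  have "{E. E \<subseteq> {1..n} \<and> card E = 0} = {{}}"
    by (auto dest: finite_subset[OF _ finite_atLeastAtMost])
  then show ?thesis by (simp add: q_binomial_def)
qed

lemma q_binomial_eq_0: "q_binomial n k = 0" if "n < k"
proof -
  have "card E \<noteq> k" if "E \<subseteq> {1..n}" for E
    using card_mono[OF _ that] \<open>n < k\<close> by simp
  then have "{E. E \<subseteq> {1..n} \<and> card E = k} = {}"
    by blast
  then show ?thesis by (simp only: q_binomial_def sum.empty)
qed

lemma strict_sorted_nth_gap:
  fixes xs :: "nat list"
  assumes "sorted_wrt (<) xs" "i \<le> j" "j < length xs"
  shows "xs ! i + (j - i) \<le> xs ! j"
  using assms(2,3)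
proof (induction j rule: dec_induct)
  case (step j)
  then have "xs ! j < xs ! Suc j"
    using assms(1) by (simp add: sorted_wrt_iff_nth_less)
  then show ?case using step by simp
qed simp

text \<open>
  This bound makes the subtractions in the exponent of \<^const>\<open>q_binomial\<close> exact, so that enlarging
  \<open>n\<close> by one raises each of the \<open>k\<close> summands by one.
\<close>
lemma card_above_nth_le:
  assumes "E \<subseteq> {1..n}" "card E = k" "i \<in> {1..k}"
  shows "k - i \<le> n - sorted_list_of_set E ! (i - 1)"
proof -
  let ?xs = "sorted_list_of_set E"
  have fin: "finite E" using assms(1) finite_subset by blast
  have "?xs ! (k - 1) \<in> set ?xs" using assms by (intro nth_mem) auto
  then have "?xs ! (k - 1) \<le> n" using assms(1) fin by auto
  moreover have "?xs ! (i - 1) + ((k - 1) - (i - 1)) \<le> ?xs ! (k - 1)"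
    using assms by (intro strict_sorted_nth_gap) auto
  ultimately show ?thesis using assms(3) by auto
qed

text \<open>
  The two terms account for the subsets that contain \<open>n + 1\<close> and those that do not. In the first case
  \<open>n + 1\<close> contributes \<open>0\<close> to the exponent, and in the second it is one more element outside the
  subset, lying above all of its \<open>k + 1\<close> elements.
\<close>
lemma q_binomial_Suc_Suc:
  "q_binomial (Suc n) (Suc k) = q_binomial n k + monom 1 (Suc k) * q_binomial n (Suc k)"
proof -
  define S where "S n k = {E. E \<subseteq> {1..n::nat} \<and> card E = k}" for n k
  define w where "w n k E = (\<Sum>i=1..k. (n - sorted_list_of_set E ! (i - 1)) - (k - i))"
    for n k :: nat and E
  have qb: "q_binomial n k = (\<Sum>E\<in>S n k. monom 1 (w n k E))" for n k
    by (simp add: q_binomial_def S_def w_def)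
  have finS: "finite (S n k)" for n k
    unfolding S_def by (rule finite_subset[of _ "Pow {1..n}"]) auto
  have finE: "finite E" if "E \<in> S n k" for E n k
    using that finite_subset[of E "{1..n}"] by (auto simp: S_def)
  have notin: "Suc n \<notin> E" if "E \<in> S n k" for E k
    using that by (auto simp: S_def)
  have split: "S (Suc n) (Suc k) = insert (Suc n) ` S n k \<union> S n (Suc k)"
  proof (intro equalityI subsetI)
    fix E assume E: "E \<in> S (Suc n) (Suc k)"
    show "E \<in> insert (Suc n) ` S n k \<union> S n (Suc k)"
    proof (cases "Suc n \<in> E")
      case True
      then have "E - {Suc n} \<in> S n k" "E = insert (Suc n) (E - {Suc n})"
        using E finE[OF E] by (auto simp: S_def)
      then show ?thesis by blast
    next
      case False
      then show ?thesis using E by (auto simp: S_def atLeastAtMostSuc_conv)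
    qed
  next
    fix E assume "E \<in> insert (Suc n) ` S n k \<union> S n (Suc k)"
    then show "E \<in> S (Suc n) (Suc k)"
    proof
      assume "E \<in> insert (Suc n) ` S n k"
      then obtain F where F: "E = insert (Suc n) F" "F \<in> S n k" by blast
      then show ?thesis using finE[OF F(2)] notin[OF F(2)] by (auto simp: S_def)
    qed (auto simp: S_def)
  qed
  have w_in: "w (Suc n) (Suc k) (insert (Suc n) E) = w n k E" if "E \<in> S n k" for E
  proof -
    have "sorted_list_of_set (insert (Suc n) E) = sorted_list_of_set E @ [Suc n]"
      using finE[OF that] notin[OF that] that
      by (auto simp: sorted_list_of_set_insert_remove S_def intro!: sorted_insort_is_snoc)
    then show ?thesis
      using that by (auto simp: w_def S_def nth_append intro!: sum.cong)
  qed
  have w_notin: "w (Suc n) (Suc k) E = Suc k + w n (Suc k) E" if "E \<in> S n (Suc k)" for E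
  proof -
    let ?x = "\<lambda>i. sorted_list_of_set E ! (i - 1)"
    have "w (Suc n) (Suc k) E = (\<Sum>i=1..Suc k. 1 + ((n - ?x i) - (Suc k - i)))"
      unfolding w_def
    proof (rule sum.cong)
      fix i assume i: "i \<in> {1..Suc k}"
      have "?x i \<in> set (sorted_list_of_set E)" using i that by (intro nth_mem) (auto simp: S_def)
      then have "?x i \<le> n" using that finE[OF that] by (auto simp: S_def)
      moreover have "Suc k - i \<le> n - ?x i"
        using card_above_nth_le[of E n "Suc k" i] i that by (simp add: S_def)
      ultimately show "(Suc n - ?x i) - (Suc k - i) = 1 + ((n - ?x i) - (Suc k - i))"
        by linarith
    qed simp
    also have "\<dots> = Suc k + w n (Suc k) E"
      by (subst sum.distrib) (simp add: w_def)
    finally show ?thesis .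
  qed
  have inj: "inj_on (insert (Suc n)) (S n k)"
    using notin by (auto simp: inj_on_def insert_ident)
  have disj: "insert (Suc n) ` S n k \<inter> S n (Suc k) = {}"
    using notin by blast
  have "q_binomial (Suc n) (Suc k) =
      (\<Sum>E\<in>S n k. monom 1 (w (Suc n) (Suc k) (insert (Suc n) E))) +
      (\<Sum>E\<in>S n (Suc k). monom 1 (w (Suc n) (Suc k) E))"
    unfolding qb split by (subst sum.union_disjoint) (simp_all add: finS disj sum.reindex[OF inj])
  also have "(\<Sum>E\<in>S n k. monom 1 (w (Suc n) (Suc k) (insert (Suc n) E))) = q_binomial n k"
    unfolding qb by (rule sum.cong[OF refl]) (simp only: w_in)
  also have "(\<Sum>E\<in>S n (Suc k). monom 1 (w (Suc n) (Suc k) E)) =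
      monom 1 (Suc k) * q_binomial n (Suc k)"
    unfolding qb sum_distrib_left by (rule sum.cong[OF refl]) (simp only: w_notin monom_1_add)
  finally show ?thesis .
qed

section \<open>The \<open>q\<close>-Vandermonde identity\<close>

text \<open>
  Here \<open>i\<close> elements of the subset lie in the first block, of size \<open>a\<close>, and each of them precedes the
  \<open>b - (k - i)\<close> elements of the second block that are outside the subset. For \<open>b < k - i\<close> the
  truncated difference does no harm, since the second \<open>q\<close>-binomial coefficient vanishes.
\<close>
lemma q_vandermonde:
  "q_binomial (a + b) k =
    (\<Sum>i\<le>k. monom 1 (i * (b - (k - i))) * q_binomial a i * q_binomial b (k - i))"
proof (induction b arbitrary: k)
  case 0
  have "(\<Sum>i\<le>k. monom 1 (i * (0 - (k - i))) * q_binomial a i * q_binomial 0 (k - i)) =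
      (\<Sum>i\<le>k. if i = k then q_binomial a k else 0)"
    by (rule sum.cong) (auto simp: q_binomial_0_right q_binomial_eq_0 monom_0 one_pCons)
  then show ?case by simp
next
  case (Suc b)
  show ?case
  proof (cases k)
    case 0
    then show ?thesis by (simp add: q_binomial_0_right)
  next
    case (Suc k')
    let ?T = "\<lambda>b k i. monom 1 (i * (b - (k - i))) * q_binomial a i * q_binomial b (k - i)"
    have Pascal: "?T (Suc b) (Suc k') i = ?T b k' i + monom 1 (Suc k') * ?T b (Suc k') i"
      if "i \<le> k'" for i
    proof -
      have e: "Suc k' - i = Suc (k' - i)" using that by simp
      have powers: "monom 1 (i * (b - (k' - i))) * monom 1 (Suc (k' - i)) * q_binomial b (Suc (k' - i)) =
          monom 1 (Suc k') * monom 1 (i * (b - Suc (k' - i))) * q_binomial b (Suc (k' - i))"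
      proof (cases "Suc (k' - i) \<le> b")
        case True
        define c where "c = b - Suc (k' - i)"
        have "b - (k' - i) = Suc c" using True by (simp add: c_def)
        then have "i * (b - (k' - i)) + Suc (k' - i) = Suc k' + i * c" using that by simp
        then show ?thesis by (simp add: mult_monom c_def)
      qed (simp add: q_binomial_eq_0)
      have "monom 1 (i * (b - (k' - i))) * q_binomial a i *
            (monom 1 (Suc (k' - i)) * q_binomial b (Suc (k' - i))) = q_binomial a i *
            (monom 1 (i * (b - (k' - i))) * monom 1 (Suc (k' - i)) * q_binomial b (Suc (k' - i)))"
        by (simp only: mult_ac)
      also have "\<dots> = monom 1 (Suc k') *
            (monom 1 (i * (b - Suc (k' - i))) * q_binomial a i * q_binomial b (Suc (k' - i)))"
        unfolding powers by (simp only: mult_ac)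
      finally show ?thesis by (simp only: e q_binomial_Suc_Suc distrib_left diff_Suc_Suc)
    qed
    have sum_Pascal: "(\<Sum>i\<le>k'. ?T (Suc b) (Suc k') i) =
        (\<Sum>i\<le>k'. ?T b k' i) + monom 1 (Suc k') * (\<Sum>i\<le>k'. ?T b (Suc k') i)"
      unfolding sum_distrib_left sum.distrib[symmetric]
      by (rule sum.cong[OF refl], rule Pascal) simp
    have last: "?T (Suc b) (Suc k') (Suc k') = monom 1 (Suc k') * ?T b (Suc k') (Suc k')"
      by (simp add: q_binomial_0_right mult_monom flip: mult.assoc)
    have "q_binomial (a + Suc b) k =
        (\<Sum>i\<le>k'. ?T b k' i) + monom 1 (Suc k') * (\<Sum>i\<le>Suc k'. ?T b (Suc k') i)"
      using Suc.IH by (simp add: Suc q_binomial_Suc_Suc)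
    also have "\<dots> = (\<Sum>i\<le>k'. ?T (Suc b) (Suc k') i) + ?T (Suc b) (Suc k') (Suc k')"
      by (simp only: sum.atMost_Suc distrib_left last sum_Pascal add.assoc)
    finally show ?thesis by (simp add: Suc)
  qed
qed

definition compositions :: "nat \<Rightarrow> nat \<Rightarrow> (nat \<Rightarrow> nat) set" where
  "compositions t K = {s \<in> {1..t} \<rightarrow>\<^sub>E UNIV. (\<Sum>u=1..t. s u) = K}"

lemma finite_compositions: "finite (compositions t K)"
proof (rule finite_subset)
  show "compositions t K \<subseteq> {1..t} \<rightarrow>\<^sub>E {..K}"
  proof
    fix s assume s: "s \<in> compositions t K"
    have "s u \<le> K" if "u \<in> {1..t}" for u
      using member_le_sum[of u "{1..t}" s] that s by (simp add: compositions_def)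
    then show "s \<in> {1..t} \<rightarrow>\<^sub>E {..K}" using s by (auto simp: compositions_def PiE_iff)
  qed
qed (simp add: finite_PiE)

lemma sum_compositions_Suc:
  "(\<Sum>s\<in>compositions (Suc t) K. F s) =
    (\<Sum>i\<le>K. \<Sum>s\<in>compositions t i. F (s(Suc t := K - i)))"
proof -
  have "(\<Sum>s\<in>compositions (Suc t) K. F s) =
      (\<Sum>(i, s)\<in>(SIGMA i:{..K}. compositions t i). F (s(Suc t := K - i)))"
  proof (rule sum.reindex_bij_witness[where
        i = "\<lambda>(i, s). s(Suc t := K - i)" and
        j = "\<lambda>s. (\<Sum>u=1..t. s u, restrict s {1..t})"])
    fix s assume s: "s \<in> compositions (Suc t) K"
    then have last: "s (Suc t) = K - (\<Sum>u=1..t. s u)" and le: "(\<Sum>u=1..t. s u) \<le> K"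
      by (auto simp: compositions_def)
    have ext: "(restrict s {1..t})(Suc t := K - (\<Sum>u=1..t. s u)) = s"
      using s last by (auto simp: compositions_def fun_eq_iff PiE_iff extensional_def)
    then show "(case (\<Sum>u=1..t. s u, restrict s {1..t}) of (i, s) \<Rightarrow> s(Suc t := K - i)) = s"
      by simp
    show "(\<Sum>u=1..t. s u, restrict s {1..t}) \<in> (SIGMA i:{..K}. compositions t i)"
      using le by (simp add: compositions_def)
    show "(case (\<Sum>u=1..t. s u, restrict s {1..t}) of (i, s) \<Rightarrow> F (s(Suc t := K - i))) = F s"
      using ext by simp
  next
    fix p assume "p \<in> (SIGMA i:{..K}. compositions t i)"
    then obtain i s where p: "p = (i, s)" "i \<le> K" "s \<in> compositions t i" by auto
    have sum: "(\<Sum>u=1..t. (s(Suc t := K - i)) u) = i"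
      using p by (simp add: compositions_def)
    have "restrict (s(Suc t := K - i)) {1..t} = s"
      using p by (auto simp: compositions_def fun_eq_iff PiE_iff extensional_def)
    with sum show "(\<Sum>u=1..t. (case p of (i, s) \<Rightarrow> s(Suc t := K - i)) u,
        restrict (case p of (i, s) \<Rightarrow> s(Suc t := K - i)) {1..t}) = p"
      using p by simp
    show "(case p of (i, s) \<Rightarrow> s(Suc t := K - i)) \<in> compositions (Suc t) K"
      using p sum by (auto simp: compositions_def PiE_iff extensional_def)
  qed
  also have "\<dots> = (\<Sum>i\<le>K. \<Sum>s\<in>compositions t i. F (s(Suc t := K - i)))"
    by (simp add: sum.Sigma finite_compositions)
  finally show ?thesis .
qed

text \<open>
  The cross exponent \<open>e\<close> grows, when block \<open>t + 1\<close> is added, by \<open>n\<^bsub>t+1\<^esub> - s\<^bsub>t+1\<^esub>\<close> for each of the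
  elements chosen in the earlier blocks. It sees them only through their total \<open>i\<close>, which is why the
  two-block identity, with the first \<open>t\<close> blocks merged into one, supplies the induction step.
\<close>
lemma q_vandermonde_blocks:
  "q_binomial (\<Sum>u=1..t. n u) K =
    (\<Sum>s\<in>compositions t K.
       monom 1 (\<Sum>u=1..t. s u * (\<Sum>i=u+1..t. n i - s i)) *
       (\<Prod>u=1..t. q_binomial (n u) (s u)))"
proof (induction t arbitrary: K)
  case 0
  have "compositions 0 K = (if K = 0 then {\<lambda>_. undefined} else {})"
    by (auto simp: compositions_def)
  then show ?case by (simp add: q_binomial_0_right q_binomial_eq_0)
next
  case (Suc t)
  define e where "e t s = (\<Sum>u=1..t. s u * (\<Sum>i=u+1..t. n i - s i))" for t s
  have e_Suc: "e (Suc t) (s(Suc t := j)) = i * (n (Suc t) - j) + e t s"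
    if "s \<in> compositions t i" for s i j
  proof -
    have "e (Suc t) (s(Suc t := j)) =
        (\<Sum>u=1..t. s u * ((\<Sum>i=u+1..t. n i - s i) + (n (Suc t) - j)))"
      by (auto simp: e_def intro!: sum.cong)
    also have "\<dots> = i * (n (Suc t) - j) + e t s"
      using that by (simp add: e_def compositions_def distrib_left sum.distrib
          flip: sum_distrib_right)
    finally show ?thesis .
  qed
  have "q_binomial (\<Sum>u=1..Suc t. n u) K =
      (\<Sum>i\<le>K. monom 1 (i * (n (Suc t) - (K - i))) * q_binomial (\<Sum>u=1..t. n u) i *
        q_binomial (n (Suc t)) (K - i))"
    by (simp add: q_vandermonde)
  also have "\<dots> = (\<Sum>i\<le>K. \<Sum>s\<in>compositions t i.
      monom 1 (e (Suc t) (s(Suc t := K - i))) *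
      (\<Prod>u=1..Suc t. q_binomial (n u) ((s(Suc t := K - i)) u)))"
  proof (intro sum.cong refl)
    fix i
    have "monom 1 (i * (n (Suc t) - (K - i))) * q_binomial (\<Sum>u=1..t. n u) i *
        q_binomial (n (Suc t)) (K - i) =
        (\<Sum>s\<in>compositions t i. monom 1 (i * (n (Suc t) - (K - i))) *
          (monom 1 (e t s) * (\<Prod>u=1..t. q_binomial (n u) (s u))) * q_binomial (n (Suc t)) (K - i))"
      by (simp only: Suc.IH e_def sum_distrib_left[where A = "compositions t i"]
          sum_distrib_right[where A = "compositions t i"])
    also have "\<dots> = (\<Sum>s\<in>compositions t i.
      monom 1 (e (Suc t) (s(Suc t := K - i))) *
      (\<Prod>u=1..Suc t. q_binomial (n u) ((s(Suc t := K - i)) u)))"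
      by (intro sum.cong refl) (simp add: e_Suc monom_1_add mult.assoc)
    finally show "monom 1 (i * (n (Suc t) - (K - i))) * q_binomial (\<Sum>u=1..t. n u) i *
        q_binomial (n (Suc t)) (K - i) = \<dots>" .
  qed
  also have "\<dots> = (\<Sum>s\<in>compositions (Suc t) K. monom 1 (e (Suc t) s) *
      (\<Prod>u=1..Suc t. q_binomial (n u) (s u)))"
    by (rule sum_compositions_Suc[symmetric])
  finally show ?case by (simp only: e_def)
qed

section \<open>Peeling off the last column\<close>

lemma q_multinomial_0: "q_multinomial n 0 k = 1"
  by (simp add: q_multinomial_def)

lemma q_multinomial_Suc:
  "q_multinomial n (Suc m) k = q_binomial n (k (Suc m)) * q_multinomial (n - k (Suc m)) m k"
proof -
  have "(\<Prod>j=1..m. q_binomial (n - (\<Sum>i=j+1..Suc m. k i)) (k j)) =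
      (\<Prod>j=1..m. q_binomial (n - k (Suc m) - (\<Sum>i=j+1..m. k i)) (k j))"
    by (rule prod.cong) (auto simp: add.commute)
  then show ?thesis by (simp add: q_multinomial_def mult.commute)
qed

lemma q_multinomial_cong:
  assumes "\<And>j. j \<in> {1..m} \<Longrightarrow> k j = k' j"
  shows "q_multinomial n m k = q_multinomial n m k'"
  unfolding q_multinomial_def
proof (rule prod.cong)
  fix j assume j: "j \<in> {1..m}"
  then have "(\<Sum>i=j+1..m. k i) = (\<Sum>i=j+1..m. k' i)"
    using assms by (intro sum.cong) auto
  then show "q_binomial (n - (\<Sum>i=j+1..m. k i)) (k j) =
      q_binomial (n - (\<Sum>i=j+1..m. k' i)) (k' j)"
    using assms[OF j] by simp
qed simp

definition append_column ::
    "nat \<Rightarrow> nat \<Rightarrow> (nat \<Rightarrow> nat) \<Rightarrow> (nat \<Rightarrow> nat \<Rightarrow> nat) \<Rightarrow> nat \<Rightarrow> nat \<Rightarrow> nat" where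
  "append_column t m s r = (\<lambda>u\<in>{1..t}. (r u)(Suc m := s u))"

text \<open>
  The bound \<open>s u \<le> n u\<close> ensures that the row sums \<open>n u - s u\<close> left to the other columns are exact.
\<close>
lemma sum_contingency_arrays_Suc:
  "(\<Sum>r\<in>contingency_arrays t (Suc m) n k. F r) =
    (\<Sum>s\<in>{s \<in> compositions t (k (Suc m)). \<forall>u\<in>{1..t}. s u \<le> n u}.
       \<Sum>r\<in>contingency_arrays t m (\<lambda>u. n u - s u) k. F (append_column t m s r))"
proof -
  let ?C = "{s \<in> compositions t (k (Suc m)). \<forall>u\<in>{1..t}. s u \<le> n u}"
  let ?A = "\<lambda>s. contingency_arrays t m (\<lambda>u. n u - s u) k"
  let ?j = "\<lambda>r. (\<lambda>u\<in>{1..t}. r u (Suc m), \<lambda>u\<in>{1..t}. restrict (r u) {1..m})"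
  have "(\<Sum>r\<in>contingency_arrays t (Suc m) n k. F r) =
      (\<Sum>(s, r)\<in>(SIGMA s:?C. ?A s). F (append_column t m s r))"
  proof (rule sum.reindex_bij_witness[where
        i = "\<lambda>(s, r). append_column t m s r" and j = ?j])
    fix r assume r: "r \<in> contingency_arrays t (Suc m) n k"
    have ext: "append_column t m (\<lambda>u\<in>{1..t}. r u (Suc m)) (\<lambda>u\<in>{1..t}. restrict (r u) {1..m}) = r"
    proof (rule ext)
      fix u
      show "append_column t m (\<lambda>u\<in>{1..t}. r u (Suc m)) (\<lambda>u\<in>{1..t}. restrict (r u) {1..m}) u = r u"
      proof (cases "u \<in> {1..t}")
        case True
        then have "r u \<in> {1..Suc m} \<rightarrow>\<^sub>E UNIV"
          using r by (auto simp: contingency_arrays_def)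
        then show ?thesis using True
          by (auto simp: append_column_def fun_eq_iff PiE_iff extensional_def)
      next
        case False
        then have "r u = undefined"
          using r PiE_arb[of r] unfolding contingency_arrays_def by blast
        then show ?thesis using False by (auto simp: append_column_def restrict_def)
      qed
    qed
    then show "(case ?j r of (s, r) \<Rightarrow> append_column t m s r) = r"
      "(case ?j r of (s, r) \<Rightarrow> F (append_column t m s r)) = F r"
      by simp_all
    have row: "(\<Sum>v=1..m. r u v) + r u (Suc m) = n u" if "u \<in> {1..t}" for u
      using r that by (simp add: contingency_arrays_def)
    have col: "(\<Sum>u=1..t. r u v) = k v" if "v \<in> {1..Suc m}" for v
      using r that by (simp add: contingency_arrays_def)
    have "(\<lambda>u\<in>{1..t}. r u (Suc m)) \<in> ?C"
      using col[of "Suc m"] row by (fastforce simp: compositions_def)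
    moreover have "(\<lambda>u\<in>{1..t}. restrict (r u) {1..m}) \<in> ?A (\<lambda>u\<in>{1..t}. r u (Suc m))"
      using col row by (fastforce simp: contingency_arrays_def)
    ultimately show "?j r \<in> (SIGMA s:?C. ?A s)" by simp
  next
    fix p assume "p \<in> (SIGMA s:?C. ?A s)"
    then obtain s r where p: "p = (s, r)" and s: "s \<in> ?C" and r: "r \<in> ?A s" by auto
    have sE: "s \<in> {1..t} \<rightarrow>\<^sub>E UNIV" and ssum: "(\<Sum>u=1..t. s u) = k (Suc m)"
      and sle: "\<And>u. u \<in> {1..t} \<Longrightarrow> s u \<le> n u"
      using s by (auto simp: compositions_def)
    have rE: "r \<in> {1..t} \<rightarrow>\<^sub>E ({1..m} \<rightarrow>\<^sub>E UNIV)"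
      and row: "\<And>u. u \<in> {1..t} \<Longrightarrow> (\<Sum>v=1..m. r u v) = n u - s u"
      and col: "\<And>v. v \<in> {1..m} \<Longrightarrow> (\<Sum>u=1..t. r u v) = k v"
      using r by (auto simp: contingency_arrays_def)
    have c1: "(\<lambda>u\<in>{1..t}. append_column t m s r u (Suc m)) = s"
      using sE by (auto simp: append_column_def fun_eq_iff PiE_iff extensional_def)
    have c2: "(\<lambda>u\<in>{1..t}. restrict (append_column t m s r u) {1..m}) = r"
    proof (rule ext)
      fix u
      show "(\<lambda>u\<in>{1..t}. restrict (append_column t m s r u) {1..m}) u = r u"
      proof (cases "u \<in> {1..t}")
        case True
        then have "r u \<in> {1..m} \<rightarrow>\<^sub>E UNIV" using rE by auto
        then show ?thesis using True
          by (auto simp: append_column_def fun_eq_iff PiE_iff extensional_def)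
      next
        case False
        then show ?thesis using PiE_arb[OF rE] by (auto simp: restrict_def)
      qed
    qed
    show "?j (case p of (s, r) \<Rightarrow> append_column t m s r) = p"
      using c1 c2 p by simp
    have "append_column t m s r \<in> {1..t} \<rightarrow>\<^sub>E ({1..Suc m} \<rightarrow>\<^sub>E UNIV)"
      using rE by (auto simp: append_column_def PiE_iff extensional_def)
    moreover have "(\<Sum>v=1..Suc m. append_column t m s r u v) = n u" if "u \<in> {1..t}" for u
    proof -
      have "(\<Sum>v=1..Suc m. append_column t m s r u v) = (\<Sum>v=1..m. r u v) + s u"
        using that by (simp add: append_column_def)
      then show ?thesis using row[OF that] sle[OF that] by simp
    qed
    moreover have "(\<Sum>u=1..t. append_column t m s r u v) = k v" if "v \<in> {1..Suc m}" for v
      using that ssum col[of v] by (cases "v = Suc m") (simp_all add: append_column_def)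
    ultimately show "(case p of (s, r) \<Rightarrow> append_column t m s r) \<in> contingency_arrays t (Suc m) n k"
      using p by (simp add: contingency_arrays_def)
  qed
  also have "\<dots> = (\<Sum>s\<in>?C. \<Sum>r\<in>?A s. F (append_column t m s r))"
    by (simp add: sum.Sigma finite_compositions finite_contingency_arrays)
  finally show ?thesis .
qed

text \<open>
  The new column \<open>s\<close> leaves the weights of the old columns unchanged, since a weight depends only on
  the columns up to its own; its own weight involves the row sums \<open>n i - s i\<close> of the old columns.
\<close>
lemma cross_weight_append_column:
  assumes r: "r \<in> contingency_arrays t m (\<lambda>u. n u - s u) k"
  shows "(\<Sum>u=1..t. \<Sum>v=2..Suc m. cross_weight t (append_column t m s r) u v) =
    (\<Sum>u=1..t. s u * (\<Sum>i=u+1..t. n i - s i)) + (\<Sum>u=1..t. \<Sum>v=2..m. cross_weight t r u v)"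
proof -
  let ?R = "append_column t m s r"
  have row: "(\<Sum>v=1..m. r u v) = n u - s u" if "u \<in> {1..t}" for u
    using r that by (simp add: contingency_arrays_def)
  have old: "cross_weight t ?R u v = cross_weight t r u v" if "u \<in> {1..t}" "v \<in> {2..m}" for u v
  proof -
    have "(\<Sum>i=u+1..t. \<Sum>j=1..v-1. ?R i j) = (\<Sum>i=u+1..t. \<Sum>j=1..v-1. r i j)"
      using that by (intro sum.cong refl) (auto simp: append_column_def)
    then show ?thesis using that by (simp add: cross_weight_def append_column_def)
  qed
  have new: "cross_weight t ?R u (Suc m) = s u * (\<Sum>i=u+1..t. n i - s i)" if "u \<in> {1..t}" for u
  proof -
    have "(\<Sum>j=1..m. ?R i j) = n i - s i" if "i \<in> {u+1..t}" for i
    proof -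
      have "(\<Sum>j=1..m. ?R i j) = (\<Sum>j=1..m. r i j)"
        using that by (intro sum.cong refl) (auto simp: append_column_def)
      then show ?thesis using row[of i] that by simp
    qed
    then show ?thesis using that by (simp add: cross_weight_def append_column_def)
  qed
  have "(\<Sum>v=2..Suc m. cross_weight t ?R u v) =
      s u * (\<Sum>i=u+1..t. n i - s i) + (\<Sum>v=2..m. cross_weight t r u v)" if "u \<in> {1..t}" for u
  proof (cases "m = 0")
    case True
    \<comment> \<open>The new column is the first one; it carries no weight because all \<open>n i - s i\<close> are \<open>0\<close>.\<close>
    then have "n i - s i = 0" if "i \<in> {u+1..t}" for i
      using row[of i] that by simp
    then show ?thesis using True by simp
  next
    case False
    then have "(\<Sum>v=2..Suc m. cross_weight t ?R u v) =
        (\<Sum>v=2..m. cross_weight t ?R u v) + cross_weight t ?R u (Suc m)"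
      by simp
    then show ?thesis using old[OF that] new[OF that] by (simp add: add.commute)
  qed
  then show ?thesis by (simp add: sum.distrib)
qed

lemma prod_q_multinomial_append_column:
  "(\<Prod>u=1..t. q_multinomial (n u) (Suc m) (append_column t m s r u)) =
    (\<Prod>u=1..t. q_binomial (n u) (s u)) * (\<Prod>u=1..t. q_multinomial (n u - s u) m (r u))"
proof -
  have "q_multinomial (n u) (Suc m) (append_column t m s r u) =
      q_binomial (n u) (s u) * q_multinomial (n u - s u) m (r u)" if "u \<in> {1..t}" for u
    using that q_multinomial_cong[of m "(r u)(Suc m := s u)" "r u"]
    by (simp add: q_multinomial_Suc append_column_def)
  then show ?thesis by (simp flip: prod.distrib)
qed

theorem proposition2p7:
  fixes m t :: nat and n k :: "nat \<Rightarrow> nat"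
  assumes "t \<ge> 1"
    and "(\<Sum>v=1..m. k v) = (\<Sum>u=1..t. n u)"
  shows "q_multinomial (\<Sum>u=1..t. n u) m k =
    (\<Sum>r\<in>contingency_arrays t m n k.
       monom 1 (\<Sum>u=1..t. \<Sum>v=2..m. cross_weight t r u v) *
       (\<Prod>u=1..t. q_multinomial (n u) m (r u)))"
  using assms(2)
proof (induction m arbitrary: n)
  case 0
  then have "contingency_arrays t 0 n k = {\<lambda>u\<in>{1..t}. \<lambda>v. undefined}"
    by (auto simp: contingency_arrays_def PiE_iff fun_eq_iff extensional_def)
  then show ?case by (simp add: q_multinomial_0)
next
  case (Suc m)
  let ?N = "\<Sum>u=1..t. n u" and ?K = "k (Suc m)"
  let ?C = "{s \<in> compositions t ?K. \<forall>u\<in>{1..t}. s u \<le> n u}"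
  let ?w = "\<lambda>s. \<Sum>u=1..t. s u * (\<Sum>i=u+1..t. n i - s i)"
  let ?b = "\<lambda>s. \<Prod>u=1..t. q_binomial (n u) (s u)"
  let ?A = "\<lambda>s. contingency_arrays t m (\<lambda>u. n u - s u) k"
  let ?c = "\<lambda>r. \<Sum>u=1..t. \<Sum>v=2..m. cross_weight t r u v"
  have IH: "q_multinomial (?N - ?K) m k =
      (\<Sum>r\<in>?A s. monom 1 (?c r) * (\<Prod>u=1..t. q_multinomial (n u - s u) m (r u)))"
    if "s \<in> ?C" for s
  proof -
    have rest: "(\<Sum>u=1..t. n u - s u) = ?N - ?K"
      using that by (subst sum_subtractf_nat) (auto simp: compositions_def)
    moreover have "(\<Sum>v=1..m. k v) = ?N - ?K"
      using Suc.prems by simp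
    ultimately show ?thesis using Suc.IH[of "\<lambda>u. n u - s u"] by simp
  qed
  \<comment> \<open>A column with an entry \<open>s u > n u\<close> extends to no array; its Vandermonde term vanishes.\<close>
  have "q_binomial ?N ?K = (\<Sum>s\<in>?C. monom 1 (?w s) * ?b s)"
    unfolding q_vandermonde_blocks
  proof (rule sum.mono_neutral_right)
    show "\<forall>s\<in>compositions t ?K - ?C. monom 1 (?w s) * ?b s = 0"
    proof
      fix s assume "s \<in> compositions t ?K - ?C"
      then obtain u where "u \<in> {1..t}" "n u < s u" by (auto simp: not_le)
      then have "?b s = 0" using q_binomial_eq_0[of "n u" "s u"] by auto
      then show "monom 1 (?w s) * ?b s = 0" by simp
    qed
  qed (auto simp: finite_compositions)
  then have "q_multinomial ?N (Suc m) k =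
      (\<Sum>s\<in>?C. monom 1 (?w s) * ?b s * q_multinomial (?N - ?K) m k)"
    by (simp add: q_multinomial_Suc sum_distrib_right)
  also have "\<dots> = (\<Sum>s\<in>?C. \<Sum>r\<in>?A s.
      monom 1 (\<Sum>u=1..t. \<Sum>v=2..Suc m. cross_weight t (append_column t m s r) u v) *
      (\<Prod>u=1..t. q_multinomial (n u) (Suc m) (append_column t m s r u)))"
  proof (rule sum.cong[OF refl])
    fix s assume s: "s \<in> ?C"
    have "monom 1 (?w s) * ?b s * q_multinomial (?N - ?K) m k = (\<Sum>r\<in>?A s.
        (monom 1 (?w s) * monom 1 (?c r)) *
        (?b s * (\<Prod>u=1..t. q_multinomial (n u - s u) m (r u))))"
      by (simp only: IH[OF s] sum_distrib_left mult_ac)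
    also have "\<dots> = (\<Sum>r\<in>?A s.
        monom 1 (\<Sum>u=1..t. \<Sum>v=2..Suc m. cross_weight t (append_column t m s r) u v) *
        (\<Prod>u=1..t. q_multinomial (n u) (Suc m) (append_column t m s r u)))"
      by (rule sum.cong[OF refl])
        (simp only: cross_weight_append_column prod_q_multinomial_append_column mult_monom mult_1)
    finally show "monom 1 (?w s) * ?b s * q_multinomial (?N - ?K) m k = \<dots>" .
  qed
  also have "\<dots> = (\<Sum>r\<in>contingency_arrays t (Suc m) n k.
      monom 1 (\<Sum>u=1..t. \<Sum>v=2..Suc m. cross_weight t r u v) *
      (\<Prod>u=1..t. q_multinomial (n u) (Suc m) (r u)))"
    by (rule sum_contingency_arrays_Suc[symmetric])
  finally show ?case .
qed

end
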